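(* Let $\mathcal{O}_{PL}$ be the pre-Lie operad of labelled rooted trees and let $\mathcal{O}^1$ be the multigraded operad of weighted labelled rooted trees $\mathcal{O}^\lambda$ at $\lambda=1$. The map $$i:\mathcal{O}_{PL}\to\mathcal{O}^1,\qquad t\longmapsto\sum_{\underline{\mu}\in(\mathbb{N}^* )^{nb(t)}}(t,\underline{\mu})$$ (extended linearly), where $nb(t)$ is the number of vertices of the labelled rooted tree $t$ and $(t,\underline{\mu})$ is the weighted tree whose vertex labelled $j$ has weight $\mu_j$, is a morphism of operads.
   Context: $K$ is a field of characteristic zero and $\mathbb{N}^*=\{1,2,\ldots\}$. Operads are symmetric operads in $K$-vector spaces. A morphism of operads is a sequence of $K$-linear $S_n$-equivariant maps, indexed by $n\in\mathbb{N}^*$, preserving the unit and the partial compositions. Rooted trees are non-planar, with edges oriented towards the root; $v(T)$ is the vertex set of $T$ and $E(T,v)$ the set of edges of $T$ arriving at $v$ (from its children). $S_n$ acts on labelled trees by permuting labels (the vertex labelled $i$ in $T$ gets label $\sigma^{-1}(i)$ in $T.\sigma$). For trees $S$ (vertices labelled by $\{1,\ldots,n\}$) and $T$ (vertices labelled by $\{1,\ldots,m\}$), a vertex $v$ of $S$ and a map $f:E(S,v)\to v(T)$, $S\circ_v^fT$ is the tree obtained by replacing $v$ by $T$ and connecting each edge $e\in E(S,v)$ to the vertex $f(e)$ of $T$. If $v$ is not the root of $S$, the edge leaving $v$ now leaves the root of $T$; otherwise the new root is the root of $T$. If $v$ has label $i$, labels of $S$ less than $i$ are kept, those of $T$ are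 increased by $i-1$, and those of $S$ greater than $i$ are increased by $m-1$. Pre-Lie operad: $\mathcal{O}_{PL,n}$ has as basis the rooted trees with vertices labelled bijectively by $\{1,\ldots,n\}$; the partial composition is $S\circ_vT=\sum_{f:E(S,v)\to v(T)}S\circ_v^fT$ and the unit is the one-vertex tree. The operad $\mathcal{O}^1$: weighted trees are pairs $(t,\underline\mu)$ with $t$ a tree labelled by $\{1,\ldots,n\}$ and $\underline\mu\in(\mathbb{N}^* )^n$, $\mu_j$ being the weight of the vertex labelled $j$. $\mathcal{O}^1_n=\prod_{\underline\mu\in(\mathbb{N}^* )^n}\mathcal{O}^1_{n,\underline\mu}$, where $\mathcal{O}^1_{n,\underline\mu}$ is spanned by the $(t,\underline\mu)$. For weighted trees, $S\circ_{v,1}T=\sum_{f:E(S,v)\to v(T)}S\circ_v^fT$ (weights of vertices being kept) if the total weight of $T$ equals the weight of $v$, and $S\circ_{v,1}T=0$ otherwise; this is extended bilinearly and componentwise to the products. The symmetric groups act by permuting labels, each vertex keeping its weight. The unit is $\sum_{n\ge1}\bullet_n$, with $\bullet_n$ the one-vertex tree of weight $n$. *)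

theory Defs
  imports
    "HOL-Library.Poly_Mapping"
    "HOL-Library.Function_Algebras"
    "HOL-Library.FuncSet"
    "HOL-Combinatorics.Permutations"
begin

section \<open>Operads in vector spaces and their morphisms\<close>

text \<open>
  The data of a symmetric operad in vector spaces over the field \<open>'k\<close>, without its axioms:
  \<open>op_space P n\<close> is the component of arity \<open>n\<close> (for \<open>n \<ge> 1\<close>), a subspace of the ambient
  type \<open>'a\<close> with scalar multiplication \<open>op_scale P\<close>; \<open>op_act P n x \<sigma>\<close> is the right action
  \<open>x.\<sigma>\<close> for \<open>\<sigma>\<close> a permutation of \<open>{1..n}\<close>; \<open>op_comp P n m i x y\<close> is the partial
  composition of \<open>x\<close> of arity \<open>n\<close> with \<open>y\<close> of arity \<open>m\<close> at the input \<open>i \<in> {1..n}\<close>.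
  Being a morphism of operads is a condition on these data only.
\<close>

record ('k, 'a) operad_data =
  op_space :: "nat \<Rightarrow> 'a set"
  op_scale :: "'k \<Rightarrow> 'a \<Rightarrow> 'a"
  op_act :: "nat \<Rightarrow> 'a \<Rightarrow> (nat \<Rightarrow> nat) \<Rightarrow> 'a"
  op_unit :: 'a
  op_comp :: "nat \<Rightarrow> nat \<Rightarrow> nat \<Rightarrow> 'a \<Rightarrow> 'a \<Rightarrow> 'a"

definition operad_morphism ::
  "('k::field, 'a::ab_group_add) operad_data \<Rightarrow> ('k, 'b::ab_group_add) operad_data
    \<Rightarrow> (nat \<Rightarrow> 'a \<Rightarrow> 'b) \<Rightarrow> bool" where
  "operad_morphism P Q f \<longleftrightarrow>
     (\<forall>n\<ge>1. \<forall>x\<in>op_space P n. f n x \<in> op_space Q n) \<and>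
     (\<forall>n\<ge>1. \<forall>x\<in>op_space P n. \<forall>y\<in>op_space P n. f n (x + y) = f n x + f n y) \<and>
     (\<forall>n\<ge>1. \<forall>c. \<forall>x\<in>op_space P n. f n (op_scale P c x) = op_scale Q c (f n x)) \<and>
     (\<forall>n\<ge>1. \<forall>\<sigma>. \<sigma> permutes {1..n} \<longrightarrow>
        (\<forall>x\<in>op_space P n. f n (op_act P n x \<sigma>) = op_act Q n (f n x) \<sigma>)) \<and>
     f 1 (op_unit P) = op_unit Q \<and>
     (\<forall>n\<ge>1. \<forall>m\<ge>1. \<forall>i\<in>{1..n}. \<forall>x\<in>op_space P n. \<forall>y\<in>op_space P m.
        f (n + m - 1) (op_comp P n m i x y) = op_comp Q n m i (f n x) (f m y))"


section \<open>Formal linear combinations\<close>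

text \<open>The vector space with basis \<open>'b\<close> is the type \<open>'b \<Rightarrow>\<^sub>0 'k\<close> of finitely supported functions.\<close>

definition lc_scale :: "'k::field \<Rightarrow> ('b \<Rightarrow>\<^sub>0 'k) \<Rightarrow> ('b \<Rightarrow>\<^sub>0 'k)" where
  "lc_scale c x = Poly_Mapping.map ((*) c) x"

definition linear_extension ::
  "('k \<Rightarrow> 'v \<Rightarrow> 'v::comm_monoid_add) \<Rightarrow> ('b \<Rightarrow> 'v) \<Rightarrow> ('b \<Rightarrow>\<^sub>0 'k::field) \<Rightarrow> 'v" where
  "linear_extension scl \<phi> x = (\<Sum>b\<in>Poly_Mapping.keys x. scl (Poly_Mapping.lookup x b) (\<phi> b))"

definition bilinear_extension ::
  "('b \<Rightarrow> 'c \<Rightarrow> ('d \<Rightarrow>\<^sub>0 'k)) \<Rightarrow> ('b \<Rightarrow>\<^sub>0 'k) \<Rightarrow> ('c \<Rightarrow>\<^sub>0 'k) \<Rightarrow> ('d \<Rightarrow>\<^sub>0 'k::field)" where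
  "bilinear_extension \<phi> x y =
     (\<Sum>b\<in>Poly_Mapping.keys x. \<Sum>c\<in>Poly_Mapping.keys y.
        lc_scale (Poly_Mapping.lookup x b * Poly_Mapping.lookup y c) (\<phi> b c))"


section \<open>Labelled rooted trees\<close>

text \<open>
  Edges are pairs \<open>(child, parent)\<close>, so they are oriented towards the root.  A tree whose vertices
  are labelled bijectively by \<open>{1..n}\<close> is represented, up to isomorphism uniquely, by the tree
  with vertex set \<open>{1..n}\<close>: every vertex is its own label.
\<close>

record rtree =
  verts :: "nat set"
  root :: nat
  edges :: "(nat \<times> nat) set"

definition rooted_tree :: "rtree \<Rightarrow> bool" where
  "rooted_tree T \<longleftrightarrow>
     finite (verts T) \<and> root T \<in> verts T \<and> edges T \<subseteq> verts T \<times> verts T \<and>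
     (\<forall>w. (root T, w) \<notin> edges T) \<and>
     (\<forall>v\<in>verts T - {root T}. \<exists>!w. (v, w) \<in> edges T) \<and>
     (\<forall>v\<in>verts T. (v, root T) \<in> (edges T)\<^sup>*)"

definition labelled_trees :: "nat \<Rightarrow> rtree set" where
  "labelled_trees n = {T. rooted_tree T \<and> verts T = {1..n}}"

definition num_verts :: "rtree \<Rightarrow> nat" where
  "num_verts T = card (verts T)"

definition in_edges :: "rtree \<Rightarrow> nat \<Rightarrow> (nat \<times> nat) set" where
  "in_edges T v = {e \<in> edges T. snd e = v}"

definition one_vertex_tree :: rtree where
  "one_vertex_tree = \<lparr>verts = {1}, root = 1, edges = {}\<rparr>"

definition relabel :: "(nat \<Rightarrow> nat) \<Rightarrow> rtree \<Rightarrow> rtree" where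
  "relabel g T = \<lparr>verts = g ` verts T, root = g (root T), edges = map_prod g g ` edges T\<rparr>"

definition tree_act :: "rtree \<Rightarrow> (nat \<Rightarrow> nat) \<Rightarrow> rtree" where
  "tree_act T \<sigma> = relabel (inv \<sigma>) T"

text \<open>
  New labels, after substitution at the vertex labelled \<open>i\<close> of a tree with \<open>m\<close> vertices, of a
  vertex \<open>j \<noteq> i\<close> of the outer tree and of a vertex \<open>j\<close> of the inner tree (labels start at 1).
\<close>

definition outer_label :: "nat \<Rightarrow> nat \<Rightarrow> nat \<Rightarrow> nat" where
  "outer_label i m j = (if j < i then j else j + m - 1)"

definition inner_label :: "nat \<Rightarrow> nat \<Rightarrow> nat" where
  "inner_label i j = j + i - 1"

text \<open>\<open>substitute i f S T\<close> is the tree obtained by replacing the vertex \<open>i\<close> of \<open>S\<close> by \<open>T\<close>, each edge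
  \<open>e\<close> of \<open>S\<close> arriving at \<open>i\<close> being connected to the vertex \<open>f e\<close> of \<open>T\<close>.\<close>

definition substitute :: "nat \<Rightarrow> (nat \<times> nat \<Rightarrow> nat) \<Rightarrow> rtree \<Rightarrow> rtree \<Rightarrow> rtree" where
  "substitute i f S T =
    (let out = outer_label i (num_verts T); inn = inner_label i in
     \<lparr>verts = out ` (verts S - {i}) \<union> inn ` verts T,
      root = (if root S = i then inn (root T) else out (root S)),
      edges = {(out a, out b) | a b. (a, b) \<in> edges S \<and> a \<noteq> i \<and> b \<noteq> i}
        \<union> {(inn a, inn b) | a b. (a, b) \<in> edges T}
        \<union> {(out a, inn (f (a, i))) | a. (a, i) \<in> in_edges S i}
        \<union> {(inn (root T), out b) | b. (i, b) \<in> edges S}\<rparr>)"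


section \<open>The pre-Lie operad\<close>

definition prelie_basis_comp :: "nat \<Rightarrow> rtree \<Rightarrow> rtree \<Rightarrow> (rtree \<Rightarrow>\<^sub>0 'k::field)" where
  "prelie_basis_comp i S T =
     (\<Sum>f \<in> in_edges S i \<rightarrow>\<^sub>E verts T. Poly_Mapping.single (substitute i f S T) 1)"

definition prelie_operad :: "('k::field, rtree \<Rightarrow>\<^sub>0 'k) operad_data" where
  "prelie_operad =
    \<lparr>op_space = (\<lambda>n. {x. Poly_Mapping.keys x \<subseteq> labelled_trees n}),
     op_scale = lc_scale,
     op_act = (\<lambda>n x \<sigma>. linear_extension lc_scale (\<lambda>T. Poly_Mapping.single (tree_act T \<sigma>) 1) x),
     op_unit = Poly_Mapping.single one_vertex_tree 1,
     op_comp = (\<lambda>n m i x y. bilinear_extension (prelie_basis_comp i) x y)\<rparr>"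


section \<open>The operad of weighted trees\<close>

text \<open>
  A weight sequence is a list; the weight of the vertex labelled \<open>j\<close> is the entry at position
  \<open>j - 1\<close>, as positions in lists start at 0.
\<close>

type_synonym wtree = "rtree \<times> nat list"

definition weights :: "nat \<Rightarrow> nat list set" where
  "weights n = {\<mu>. length \<mu> = n \<and> (\<forall>k\<in>set \<mu>. k \<ge> 1)}"

definition weight_of :: "nat list \<Rightarrow> nat \<Rightarrow> nat" where
  "weight_of \<mu> j = \<mu> ! (j - 1)"

text \<open>Weights move together with their vertices: the vertex labelled \<open>j\<close> in \<open>T.\<sigma>\<close> was labelled
  \<open>\<sigma> j\<close> in \<open>T\<close>.\<close>

definition weights_act :: "nat list \<Rightarrow> (nat \<Rightarrow> nat) \<Rightarrow> nat list" where
  "weights_act \<mu> \<sigma> = map (\<lambda>j. weight_of \<mu> (\<sigma> j)) [1..<length \<mu> + 1]"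

text \<open>The entry of the vertex labelled \<open>i\<close> is replaced by the weights of the inserted tree.\<close>

definition weights_comp :: "nat \<Rightarrow> nat list \<Rightarrow> nat list \<Rightarrow> nat list" where
  "weights_comp i \<mu> \<nu> = take (i - 1) \<mu> @ \<nu> @ drop i \<mu>"

definition wtree_act :: "wtree \<Rightarrow> (nat \<Rightarrow> nat) \<Rightarrow> wtree" where
  "wtree_act = (\<lambda>(T, \<mu>) \<sigma>. (tree_act T \<sigma>, weights_act \<mu> \<sigma>))"

definition wtree_basis_comp :: "nat \<Rightarrow> wtree \<Rightarrow> wtree \<Rightarrow> (wtree \<Rightarrow>\<^sub>0 'k::field)" where
  "wtree_basis_comp i = (\<lambda>(S, \<mu>) (T, \<nu>).
     if sum_list \<nu> = weight_of \<mu> i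
     then (\<Sum>f \<in> in_edges S i \<rightarrow>\<^sub>E verts T.
             Poly_Mapping.single (substitute i f S T, weights_comp i \<mu> \<nu>) 1)
     else 0)"

text \<open>
  An element of the product over all \<open>\<mu> \<in> weights n\<close> is a family indexed by weight sequences that
  vanishes outside \<open>weights n\<close>.
\<close>

definition wtree_space :: "nat \<Rightarrow> (nat list \<Rightarrow> (wtree \<Rightarrow>\<^sub>0 'k::field)) set" where
  "wtree_space n =
    {x. (\<forall>\<mu>\<in>weights n. Poly_Mapping.keys (x \<mu>) \<subseteq> labelled_trees n \<times> {\<mu>}) \<and>
        (\<forall>\<mu>. \<mu> \<notin> weights n \<longrightarrow> x \<mu> = 0)}"

definition family_scale ::
  "'k::field \<Rightarrow> (nat list \<Rightarrow> (wtree \<Rightarrow>\<^sub>0 'k)) \<Rightarrow> (nat list \<Rightarrow> (wtree \<Rightarrow>\<^sub>0 'k))" where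
  "family_scale c x = (\<lambda>\<mu>. lc_scale c (x \<mu>))"

text \<open>
  Componentwise extension: the component of index \<open>\<rho>\<close> collects the contributions of all components
  of the arguments whose image lies in the component \<open>\<rho>\<close>.  In \<open>wtree_comp\<close>, the condition on
  \<open>sum_list \<nu>\<close> only discards pairs whose composition vanishes by definition; it makes the
  index set finite, which is needed because a sum over an infinite set is 0 by convention.
\<close>

definition wtree_family_act ::
  "nat \<Rightarrow> (nat list \<Rightarrow> (wtree \<Rightarrow>\<^sub>0 'k::field)) \<Rightarrow> (nat \<Rightarrow> nat) \<Rightarrow> (nat list \<Rightarrow> (wtree \<Rightarrow>\<^sub>0 'k))" where
  "wtree_family_act n x \<sigma> = (\<lambda>\<rho>.
     \<Sum>\<mu> \<in> {\<mu> \<in> weights n. weights_act \<mu> \<sigma> = \<rho>}.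
       linear_extension lc_scale (\<lambda>t. Poly_Mapping.single (wtree_act t \<sigma>) 1) (x \<mu>))"

definition wtree_comp ::
  "nat \<Rightarrow> nat \<Rightarrow> nat \<Rightarrow> (nat list \<Rightarrow> (wtree \<Rightarrow>\<^sub>0 'k::field)) \<Rightarrow> (nat list \<Rightarrow> (wtree \<Rightarrow>\<^sub>0 'k))
    \<Rightarrow> (nat list \<Rightarrow> (wtree \<Rightarrow>\<^sub>0 'k))" where
  "wtree_comp n m i x y = (\<lambda>\<rho>.
     \<Sum>(\<mu>, \<nu>) \<in> {(\<mu>, \<nu>). \<mu> \<in> weights n \<and> \<nu> \<in> weights m \<and>
                      sum_list \<nu> = weight_of \<mu> i \<and> weights_comp i \<mu> \<nu> = \<rho>}.
       bilinear_extension (wtree_basis_comp i) (x \<mu>) (y \<nu>))"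

definition all_weightings :: "rtree \<Rightarrow> (nat list \<Rightarrow> (wtree \<Rightarrow>\<^sub>0 'k::field))" where
  "all_weightings T =
     (\<lambda>\<mu>. if \<mu> \<in> weights (num_verts T) then Poly_Mapping.single (T, \<mu>) 1 else 0)"

text \<open>The unit is the family of all weighted one-vertex trees.\<close>

definition wtree_operad :: "('k::field, nat list \<Rightarrow> (wtree \<Rightarrow>\<^sub>0 'k)) operad_data" where
  "wtree_operad =
    \<lparr>op_space = wtree_space,
     op_scale = family_scale,
     op_act = wtree_family_act,
     op_unit = (\<lambda>\<mu>. if \<mu> \<in> weights 1 then Poly_Mapping.single (one_vertex_tree, \<mu>) 1 else 0),
     op_comp = wtree_comp\<rparr>"

definition weighting_map :: "(rtree \<Rightarrow>\<^sub>0 'k::field) \<Rightarrow> (nat list \<Rightarrow> (wtree \<Rightarrow>\<^sub>0 'k))" where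
  "weighting_map = linear_extension family_scale all_weightings"

end

theory Submission
  imports Defs HOL.Vector_Spaces
begin

text \<open>
  Every operation involved is linear or bilinear, and compatible with the (bi)linear extensions of
  maps given on trees; for the infinite product this is because each component of a composition is
  a sum of contributions of components of the arguments, over an index set that does not depend on
  the arguments.  All conditions therefore reduce to a statement about trees, for the families
  \<open>all_weightings T\<close>.

  On trees, the point is that a weighting of a composed tree can be decomposed in exactly one way.
  For a permutation this says that \<open>weights_act\<close> is a bijection of the weight sequences of length
  \<open>n\<close> (\<open>weights_act_fibre\<close>).  For a composition at \<open>i\<close> the weights \<open>\<nu>\<close> of the inserted tree are a
  block of the weights \<open>\<rho>\<close> of the composed tree, and the condition of \<open>\<O>\<^sup>1\<close> forces the weight of the
  replaced vertex to be the sum of \<open>\<nu>\<close>, which is positive since the inserted tree is not empty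
  (\<open>weights_comp_fibre\<close>).  Hence every pair consisting of a grafting map \<open>f\<close> and a weighting of
  \<open>substitute i f S T\<close> is produced exactly once by composing the weightings of \<open>S\<close> with those of
  \<open>T\<close>, as it is by weighting the composition of \<open>S\<close> and \<open>T\<close>.
\<close>

section \<open>Linear extensions\<close>

lemma lookup_lc_scale: "Poly_Mapping.lookup (lc_scale c x) b = c * Poly_Mapping.lookup x b"
  by (simp add: lc_scale_def Poly_Mapping.map.rep_eq when_def)

lemma vector_space_lc_scale: "vector_space (lc_scale :: 'k::field \<Rightarrow> ('b \<Rightarrow>\<^sub>0 'k) \<Rightarrow> _)"
  by unfold_locales
    (auto intro!: poly_mapping_eqI simp: lookup_lc_scale lookup_add algebra_simps)

interpretation lc: vector_space "lc_scale :: 'k::field \<Rightarrow> ('b \<Rightarrow>\<^sub>0 'k) \<Rightarrow> _"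
  by (rule vector_space_lc_scale)

interpretation family:
  vector_space "family_scale :: 'k::field \<Rightarrow> (nat list \<Rightarrow> (wtree \<Rightarrow>\<^sub>0 'k)) \<Rightarrow> _"
  by unfold_locales
    (auto simp: family_scale_def fun_eq_iff lc.scale_right_distrib lc.scale_left_distrib)

context vector_space
begin

lemma linear_extension_superset:
  fixes x :: "'d \<Rightarrow>\<^sub>0 'a"
  assumes "finite A" "Poly_Mapping.keys x \<subseteq> A"
  shows "linear_extension scale \<phi> x = (\<Sum>b\<in>A. scale (Poly_Mapping.lookup x b) (\<phi> b))"
  unfolding linear_extension_def
  by (rule sum.mono_neutral_left) (use assms in \<open>auto simp: in_keys_iff\<close>)

lemma linear_extension_zero [simp]: "linear_extension scale \<phi> 0 = 0"
  by (simp add: linear_extension_def)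

lemma linear_extension_add:
  "linear_extension scale \<phi> (x + y) = linear_extension scale \<phi> x + linear_extension scale \<phi> y"
proof -
  let ?A = "Poly_Mapping.keys x \<union> Poly_Mapping.keys y"
  have "Poly_Mapping.keys (x + y) \<subseteq> ?A" by (rule Poly_Mapping.keys_add)
  then show ?thesis
    by (simp add: linear_extension_superset[of ?A] lookup_add scale_left_distrib sum.distrib)
qed

lemma linear_extension_scale:
  "linear_extension scale \<phi> (lc_scale c x) = scale c (linear_extension scale \<phi> x)"
proof -
  have "Poly_Mapping.keys (lc_scale c x) \<subseteq> Poly_Mapping.keys x"
    by (auto simp: in_keys_iff lookup_lc_scale)
  then show ?thesis
    by (simp add: linear_extension_superset[of "Poly_Mapping.keys x"] lookup_lc_scale
        scale_sum_right)
qed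

lemma linear_extension_sum:
  "linear_extension scale \<phi> (\<Sum>j\<in>J. x j) = (\<Sum>j\<in>J. linear_extension scale \<phi> (x j))"
  by (induction J rule: infinite_finite_induct) (auto simp: linear_extension_add)

lemma linear_extension_single [simp]:
  "linear_extension scale \<phi> (Poly_Mapping.single b 1) = \<phi> b"
  by (simp add: linear_extension_def)

lemma linear_extension_compose:
  "linear_extension scale \<phi> (linear_extension lc_scale \<psi> x)
    = linear_extension scale (\<lambda>b. linear_extension scale \<phi> (\<psi> b)) x"
  by (simp add: linear_extension_def[of lc_scale] linear_extension_sum linear_extension_scale)
    (simp add: linear_extension_def)

lemma linear_extension_sum_right:
  "(\<Sum>j\<in>J. linear_extension scale (\<phi> j) x) = linear_extension scale (\<lambda>b. \<Sum>j\<in>J. \<phi> j b) x"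
  unfolding linear_extension_def scale_sum_right by (rule sum.swap)

end

lemma linear_extension_cong:
  assumes "\<And>b. b \<in> Poly_Mapping.keys x \<Longrightarrow> \<phi> b = \<psi> b"
  shows "linear_extension scl \<phi> x = linear_extension scl \<psi> x"
  unfolding linear_extension_def using assms by (intro sum.cong) auto

lemma bilinear_extension_iterated:
  "bilinear_extension \<phi> x y
    = linear_extension lc_scale (\<lambda>b. linear_extension lc_scale (\<phi> b) y) x"
  by (simp add: bilinear_extension_def linear_extension_def lc.scale_sum_right)

lemma linear_extension_swap:
  "linear_extension lc_scale (\<lambda>b. linear_extension lc_scale (\<phi> b) y) x
    = linear_extension lc_scale (\<lambda>c. linear_extension lc_scale (\<lambda>b. \<phi> b c) x) y"
  unfolding linear_extension_def lc.scale_sum_right lc.scale_scale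
  by (subst sum.swap) (simp add: mult.commute)

lemma bilinear_extension_compose:
  "bilinear_extension \<phi> (linear_extension lc_scale \<psi> x) (linear_extension lc_scale \<chi> y)
    = linear_extension lc_scale
        (\<lambda>b. linear_extension lc_scale (\<lambda>c. bilinear_extension \<phi> (\<psi> b) (\<chi> c)) y) x"
  unfolding bilinear_extension_iterated lc.linear_extension_compose
  by (subst (2) linear_extension_swap) simp

lemma sum_fun_apply: "(\<Sum>a\<in>A. f a) x = (\<Sum>a\<in>A. f a x)"
  by (induction A rule: infinite_finite_induct) auto

lemma linear_extension_family_component:
  "linear_extension family_scale \<phi> x \<mu> = linear_extension lc_scale (\<lambda>b. \<phi> b \<mu>) x"
  by (simp add: linear_extension_def family_scale_def sum_fun_apply)

lemma wtree_family_act_linear_extension: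
  "wtree_family_act n (linear_extension family_scale \<phi> x) \<sigma>
    = linear_extension family_scale (\<lambda>b. wtree_family_act n (\<phi> b) \<sigma>) x"
  by (simp add: fun_eq_iff wtree_family_act_def linear_extension_family_component
      lc.linear_extension_compose lc.linear_extension_sum_right)

text \<open>
  The composition of the product is not determined by its values on single weighted trees, because
  elements of the product are infinite sums of those.  Its compatibility with finite linear
  combinations of families is enough here, since \<open>weighting_map x\<close> is a finite linear combination
  of the families \<open>all_weightings T\<close>.
\<close>

lemma wtree_comp_linear_extension:
  "wtree_comp n m i (linear_extension family_scale \<phi> x) (linear_extension family_scale \<psi> y)
    = linear_extension family_scale
        (\<lambda>b. linear_extension family_scale (\<lambda>c. wtree_comp n m i (\<phi> b) (\<psi> c)) y) x"
  by (simp add: fun_eq_iff wtree_comp_def linear_extension_family_component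
      bilinear_extension_compose lc.linear_extension_sum_right case_prod_unfold)

section \<open>Weight sequences\<close>

lemma weights_nth: "\<mu> \<in> weights n \<longleftrightarrow> length \<mu> = n \<and> (\<forall>j\<in>{1..n}. 1 \<le> weight_of \<mu> j)"
proof -
  have "(\<forall>k\<in>set \<mu>. 1 \<le> k) \<longleftrightarrow> (\<forall>j\<in>{1..length \<mu>}. 1 \<le> \<mu> ! (j - 1))"
    by (metis (no_types, lifting) Suc_eq_plus1 Suc_leI add_diff_cancel_right' atLeastAtMost_iff
        diff_less in_set_conv_nth le_add2 less_le_trans less_one not_less)
  then show ?thesis by (auto simp: weights_def weight_of_def)
qed

lemma weight_of_weights_act:
  "j \<in> {1..length \<mu>} \<Longrightarrow> weight_of (weights_act \<mu> \<sigma>) j = weight_of \<mu> (\<sigma> j)"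
  by (auto simp: weights_act_def weight_of_def nth_map simp del: upt_Suc)

lemma length_weights_act [simp]: "length (weights_act \<mu> \<sigma>) = length \<mu>"
  by (simp add: weights_act_def del: upt_Suc)

lemma weight_sequence_eqI:
  assumes "length \<mu> = length \<nu>" "\<And>j. j \<in> {1..length \<mu>} \<Longrightarrow> weight_of \<mu> j = weight_of \<nu> j"
  shows "\<mu> = \<nu>"
proof (rule nth_equalityI)
  fix k assume "k < length \<mu>"
  then show "\<mu> ! k = \<nu> ! k" using assms(2)[of "Suc k"] by (simp add: weight_of_def)
qed fact

lemma weights_act_in_weights:
  assumes "\<sigma> permutes {1..n}" "\<mu> \<in> weights n"
  shows "weights_act \<mu> \<sigma> \<in> weights n"
  using assms permutes_in_image[OF assms(1)]
  by (auto simp: weights_nth weight_of_weights_act)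

lemma weights_act_act:
  assumes "\<sigma> permutes {1..n}" "\<tau> permutes {1..n}" "length \<mu> = n"
  shows "weights_act (weights_act \<mu> \<sigma>) \<tau> = weights_act \<mu> (\<sigma> \<circ> \<tau>)"
  using assms permutes_in_image[OF assms(2)]
  by (intro weight_sequence_eqI) (auto simp: weight_of_weights_act)

lemma weights_act_id: "weights_act \<mu> id = \<mu>"
  by (rule weight_sequence_eqI) (auto simp: weight_of_weights_act)

text \<open>
  Since weights are permuted bijectively, only one weighting of \<open>T\<close> contributes to a given
  weighting of \<open>T.\<sigma>\<close>, so that the sum in \<open>wtree_family_act\<close> has at most one term.
\<close>

lemma weights_act_fibre:
  assumes \<sigma>: "\<sigma> permutes {1..n}"
  shows "{\<mu> \<in> weights n. weights_act \<mu> \<sigma> = \<rho>}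
    = (if \<rho> \<in> weights n then {weights_act \<rho> (inv \<sigma>)} else {})"
proof -
  note inv = permutes_inv[OF \<sigma>]
  have len: "length \<mu> = n" if "\<mu> \<in> weights n" for \<mu> using that by (simp add: weights_def)
  show ?thesis
    using weights_act_in_weights[OF \<sigma>] weights_act_in_weights[OF inv] len
      weights_act_act[OF \<sigma> inv] weights_act_act[OF inv \<sigma>] permutes_inv_o[OF \<sigma>]
    by (auto simp: weights_act_id)
qed

text \<open>
  The weights of a composed tree determine those of the two factors: the inserted block is
  \<open>\<nu>\<close>, and the weight lost at position \<open>i\<close> is recovered as its sum.  The hypothesis \<open>m \<ge> 1\<close> makes
  this sum a positive weight.
\<close>

lemma weights_comp_fibre:
  assumes "i \<in> {1..n}" "1 \<le> m"
  obtains \<mu> \<nu> where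
    "{(\<mu>, \<nu>). \<mu> \<in> weights n \<and> \<nu> \<in> weights m \<and> sum_list \<nu> = weight_of \<mu> i
        \<and> weights_comp i \<mu> \<nu> = \<rho>}
      = (if \<rho> \<in> weights (n + m - 1) then {(\<mu>, \<nu>)} else {})"
proof -
  define \<nu>0 where "\<nu>0 = take m (drop (i - 1) \<rho>)"
  define \<mu>0 where "\<mu>0 = take (i - 1) \<rho> @ sum_list \<nu>0 # drop (i - 1 + m) \<rho>"
  have i: "i - 1 < n" "Suc (i - 1) = i" using assms(1) by auto
  have comp: "weights_comp i \<mu> \<nu> \<in> weights (n + m - 1)"
    if "\<mu> \<in> weights n" "\<nu> \<in> weights m" for \<mu> \<nu>
    using that assms by (auto simp: weights_def weights_comp_def dest: in_set_takeD in_set_dropD)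
  have unique: "\<nu> = \<nu>0 \<and> \<mu> = \<mu>0"
    if "\<mu> \<in> weights n" "\<nu> \<in> weights m" "sum_list \<nu> = weight_of \<mu> i" "weights_comp i \<mu> \<nu> = \<rho>"
    for \<mu> \<nu>
  proof -
    have len: "length \<mu> = n" "length \<nu> = m" using that by (auto simp: weights_def)
    have \<rho>: "\<rho> = take (i - 1) \<mu> @ \<nu> @ drop i \<mu>" using that by (simp add: weights_comp_def)
    have "\<nu> = \<nu>0" using \<rho> len assms by (simp add: \<nu>0_def min_def)
    moreover have "\<mu> = take (i - 1) \<mu> @ \<mu> ! (i - 1) # drop i \<mu>"
      by (metis id_take_nth_drop i len(1))
    ultimately show ?thesis using \<rho> len assms i that(3)
      by (simp add: \<mu>0_def weight_of_def min_def)
  qed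
  have exists: "\<mu>0 \<in> weights n \<and> \<nu>0 \<in> weights m \<and> sum_list \<nu>0 = weight_of \<mu>0 i
      \<and> weights_comp i \<mu>0 \<nu>0 = \<rho>" if "\<rho> \<in> weights (n + m - 1)"
  proof -
    have len: "length \<rho> = n + m - 1" and pos: "\<And>k. k \<in> set \<rho> \<Longrightarrow> 1 \<le> k"
      using that by (auto simp: weights_def)
    have \<nu>0: "\<nu>0 \<in> weights m"
      using len pos assms by (auto simp: weights_def \<nu>0_def dest!: in_set_takeD in_set_dropD)
    then have "1 \<le> sum_list \<nu>0"
      using assms(2) by (cases \<nu>0) (auto simp: weights_def)
    then have \<mu>0: "\<mu>0 \<in> weights n"
      using len pos assms by (auto simp: weights_def \<mu>0_def dest!: in_set_takeD in_set_dropD)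
    have "drop i \<mu>0 = drop (i - 1 + m) \<rho>" "take (i - 1) \<mu>0 = take (i - 1) \<rho>"
      "\<mu>0 ! (i - 1) = sum_list \<nu>0"
      using len assms by (auto simp: \<mu>0_def nth_append drop_Cons')
    moreover have "take (i - 1) \<rho> @ \<nu>0 @ drop (i - 1 + m) \<rho> = \<rho>"
      unfolding \<nu>0_def by (metis add.commute append_take_drop_id drop_drop)
    ultimately show ?thesis using \<nu>0 \<mu>0 by (simp add: weights_comp_def weight_of_def)
  qed
  have "{(\<mu>, \<nu>). \<mu> \<in> weights n \<and> \<nu> \<in> weights m \<and> sum_list \<nu> = weight_of \<mu> i
        \<and> weights_comp i \<mu> \<nu> = \<rho>}
      = (if \<rho> \<in> weights (n + m - 1) then {(\<mu>0, \<nu>0)} else {})"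
    using comp unique exists by auto
  then show ?thesis by (rule that)
qed

section \<open>The weighting map on trees\<close>

lemma num_verts_labelled: "T \<in> labelled_trees n \<Longrightarrow> num_verts T = n"
  by (simp add: labelled_trees_def num_verts_def)

text \<open>
  The components in which \<open>all_weightings T\<close> lives are given by the number of vertices of \<open>T\<close>, which
  is computed next for permuted and for composed trees.
\<close>

lemma num_verts_tree_act:
  assumes "\<sigma> permutes {1..n}" "T \<in> labelled_trees n"
  shows "num_verts (tree_act T \<sigma>) = n"
  using permutes_image[OF permutes_inv[OF assms(1)]] assms(2)
  by (simp add: labelled_trees_def num_verts_def tree_act_def relabel_def)

lemma labels_after_substitution:
  assumes "i \<in> {1..n}" "1 \<le> m"
  shows "outer_label i m ` ({1..n} - {i}) \<union> inner_label i ` {1..m} = {1..n + m - 1}"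
    (is "?O \<union> ?I = _")
proof
  show "?O \<union> ?I \<subseteq> {1..n + m - 1}"
    using assms by (auto simp: outer_label_def inner_label_def)
  show "{1..n + m - 1} \<subseteq> ?O \<union> ?I"
  proof
    fix j assume j: "j \<in> {1..n + m - 1}"
    consider "j < i" | "i \<le> j" "j < i + m" | "i + m \<le> j" by linarith
    then show "j \<in> ?O \<union> ?I"
    proof cases
      case 1
      then have "j = outer_label i m j" "j \<in> {1..n} - {i}"
        using j assms by (auto simp: outer_label_def)
      then show ?thesis by blast
    next
      case 2
      then have "j = inner_label i (j + 1 - i)" "j + 1 - i \<in> {1..m}"
        using j assms by (auto simp: inner_label_def)
      then show ?thesis by blast
    next
      case 3
      then have "j = outer_label i m (j + 1 - m)" "j + 1 - m \<in> {1..n} - {i}"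
        using j assms by (auto simp: outer_label_def)
      then show ?thesis by blast
    qed
  qed
qed

lemma num_verts_substitute:
  assumes "i \<in> {1..n}" "1 \<le> m" "S \<in> labelled_trees n" "T \<in> labelled_trees m"
  shows "num_verts (substitute i f S T) = n + m - 1"
  using labels_after_substitution[OF assms(1,2)] assms(3,4)
  by (simp add: num_verts_def substitute_def labelled_trees_def Let_def)

lemma all_weightings_in_wtree_space:
  assumes "T \<in> labelled_trees n"
  shows "all_weightings T \<in> wtree_space n"
  using assms by (simp add: wtree_space_def all_weightings_def num_verts_labelled)

lemma linear_extension_in_wtree_space:
  assumes "\<And>b. b \<in> Poly_Mapping.keys x \<Longrightarrow> \<phi> b \<in> wtree_space n"
  shows "linear_extension family_scale \<phi> x \<in> wtree_space n"
proof -
  have "Poly_Mapping.keys (linear_extension family_scale \<phi> x \<mu>) \<subseteq> labelled_trees n \<times> {\<mu>}"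
    if "\<mu> \<in> weights n" for \<mu>
  proof -
    have "Poly_Mapping.keys (lc_scale c (\<phi> b \<mu>)) \<subseteq> labelled_trees n \<times> {\<mu>}"
      if "b \<in> Poly_Mapping.keys x" for b c
      using assms[OF that] \<open>\<mu> \<in> weights n\<close>
      by (fastforce simp: wtree_space_def in_keys_iff lookup_lc_scale)
    then show ?thesis
      unfolding linear_extension_family_component
      unfolding linear_extension_def
      by (intro order.trans[OF keys_sum]) blast
  qed
  moreover have "linear_extension family_scale \<phi> x \<mu> = 0" if "\<mu> \<notin> weights n" for \<mu>
    unfolding linear_extension_family_component
    using assms that by (simp add: linear_extension_def wtree_space_def)
  ultimately show ?thesis by (simp add: wtree_space_def)
qed

lemma all_weightings_equivariant:
  assumes "\<sigma> permutes {1..n}" "T \<in> labelled_trees n"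
  shows "wtree_family_act n (all_weightings T) \<sigma> = all_weightings (tree_act T \<sigma>)"
proof
  fix \<rho>
  let ?\<mu> = "weights_act \<rho> (inv \<sigma>)"
  have "?\<mu> \<in> weights n \<and> weights_act ?\<mu> \<sigma> = \<rho>" if "\<rho> \<in> weights n"
    using weights_act_fibre[OF assms(1), of \<rho>] that by auto
  then show "wtree_family_act n (all_weightings T) \<sigma> \<rho> = all_weightings (tree_act T \<sigma>) \<rho>"
    unfolding wtree_family_act_def weights_act_fibre[OF assms(1)]
    by (simp add: all_weightings_def num_verts_tree_act[OF assms] num_verts_labelled[OF assms(2)]
        wtree_act_def)
qed

text \<open>
  In the component \<open>\<rho>\<close>, only the pair of weightings given by \<open>weights_comp_fibre\<close> contributes, and it
  contributes each grafting map \<open>f\<close> with coefficient 1.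
\<close>

lemma all_weightings_comp:
  assumes "i \<in> {1..n}" "1 \<le> m" "S \<in> labelled_trees n" "T \<in> labelled_trees m"
  shows "wtree_comp n m i (all_weightings S) (all_weightings T)
    = (\<Sum>f \<in> in_edges S i \<rightarrow>\<^sub>E verts T. all_weightings (substitute i f S T))"
proof
  fix \<rho>
  obtain \<mu> \<nu> where fibre:
    "{(\<mu>, \<nu>). \<mu> \<in> weights n \<and> \<nu> \<in> weights m \<and> sum_list \<nu> = weight_of \<mu> i
        \<and> weights_comp i \<mu> \<nu> = \<rho>}
      = (if \<rho> \<in> weights (n + m - 1) then {(\<mu>, \<nu>)} else {})"
    using weights_comp_fibre[OF assms(1,2)] .
  have "\<mu> \<in> weights n \<and> \<nu> \<in> weights m \<and> sum_list \<nu> = weight_of \<mu> i \<and> weights_comp i \<mu> \<nu> = \<rho>"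
    if "\<rho> \<in> weights (n + m - 1)"
    using fibre that by auto
  then show "wtree_comp n m i (all_weightings S) (all_weightings T) \<rho>
    = (\<Sum>f \<in> in_edges S i \<rightarrow>\<^sub>E verts T. all_weightings (substitute i f S T)) \<rho>"
    unfolding wtree_comp_def fibre
    by (simp add: all_weightings_def num_verts_labelled[OF assms(3)]
        num_verts_labelled[OF assms(4)] num_verts_substitute[OF assms]
        bilinear_extension_iterated wtree_basis_comp_def sum_fun_apply)
qed

section \<open>The weighting map is a morphism of operads\<close>

theorem theorem15:
  shows "operad_morphism
    (prelie_operad :: ('k::field_char_0, rtree \<Rightarrow>\<^sub>0 'k) operad_data)
    wtree_operad
    (\<lambda>n. weighting_map)"
proof -
  let ?W = "weighting_map :: (rtree \<Rightarrow>\<^sub>0 'k) \<Rightarrow> _"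
  let ?space = "\<lambda>n. {x :: rtree \<Rightarrow>\<^sub>0 'k. Poly_Mapping.keys x \<subseteq> labelled_trees n}"
  have space: "?W x \<in> wtree_space n" if "x \<in> ?space n" for n x
    unfolding weighting_map_def using that
    by (intro linear_extension_in_wtree_space all_weightings_in_wtree_space) auto
  have act: "?W (linear_extension lc_scale (\<lambda>T. Poly_Mapping.single (tree_act T \<sigma>) 1) x)
      = wtree_family_act n (?W x) \<sigma>"
    if "\<sigma> permutes {1..n}" "x \<in> ?space n" for n x \<sigma>
    unfolding weighting_map_def family.linear_extension_compose wtree_family_act_linear_extension
      family.linear_extension_single
    using that by (intro linear_extension_cong all_weightings_equivariant[symmetric]) auto
  have unit: "?W (Poly_Mapping.single one_vertex_tree 1)
      = (\<lambda>\<mu>. if \<mu> \<in> weights 1 then Poly_Mapping.single (one_vertex_tree, \<mu>) 1 else 0)"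
    unfolding weighting_map_def family.linear_extension_single all_weightings_def
    by (simp add: num_verts_def one_vertex_tree_def)
  have basis: "?W (prelie_basis_comp i S T)
      = wtree_comp n m i (all_weightings S) (all_weightings T)"
    if "i \<in> {1..n}" "1 \<le> m" "S \<in> labelled_trees n" "T \<in> labelled_trees m" for n m i S T
    unfolding all_weightings_comp[OF that] weighting_map_def prelie_basis_comp_def
    by (simp add: family.linear_extension_sum)
  have comp: "?W (bilinear_extension (prelie_basis_comp i) x y)
      = wtree_comp n m i (?W x) (?W y)"
    if "1 \<le> m" "i \<in> {1..n}" "x \<in> ?space n" "y \<in> ?space m" for n m i x y
    unfolding weighting_map_def bilinear_extension_iterated family.linear_extension_compose
      wtree_comp_linear_extension
    using that by (intro linear_extension_cong basis[unfolded weighting_map_def]) auto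
  have "?W (x + y) = ?W x + ?W y" "?W (lc_scale c x) = family_scale c (?W x)" for x y c
    by (simp_all add: weighting_map_def family.linear_extension_add family.linear_extension_scale)
  then show ?thesis
    using space act unit comp
    by (simp add: operad_morphism_def prelie_operad_def wtree_operad_def)
qed

end
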